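(* Let $\Upsilon$ be a set of positions. Then $\mathcal{M}_{\mathrm{cl}(\Upsilon)} \cong \mathcal{M}_{\mathrm{cl}( * )}$ (as misère monoids) if and only if all of the following hold: (1) $\Upsilon$ contains a position other than $0$; (2) for every $\xi \in \mathrm{cl}(\Upsilon)$, $o^-(\xi) \in \{\mathcal{N}, \mathcal{P}\}$; (3) for every $\xi \in \mathrm{cl}(\Upsilon)$ with $o^-(\xi) = \mathcal{N}$, every Left option $\xi^L$ of $\xi$ satisfies $o^-(\xi^L) = \mathcal{P}$ and every Right option $\xi^R$ of $\xi$ satisfies $o^-(\xi^R)=\mathcal{P}$.
   Context: A position $\xi=\{\xi^L \mid \xi^R\}$ is given recursively by finite sets of Left options and Right options (finite game tree); $\cdot$ denotes an empty option set. $0=\{\cdot\mid\cdot\}$, $*=\{0\mid 0\}$. The disjunctive sum is $\alpha+\beta=\{\alpha^L+\beta,\alpha+\beta^L \mid \alpha^R+\beta,\alpha+\beta^R\}$. Under misère play a player unable to move on their turn wins. The misère outcome $o^-(\xi)$ is $\mathcal{L}$ (Left wins moving first and second), $\mathcal{R}$ (Right wins moving first and second), $\mathcal{N}$ (the player to move next wins) or $\mathcal{P}$ (the player to move next loses). A set of positions is closed if it is closed under disjunctive sum and under taking options; $\mathrm{cl}(\Upsilon)$ is the smallest closed set containing $\Upsilon$. For a closed set $\Gamma$ and $\alpha,\beta\in\Gamma$, $\alpha\equiv\beta \pmod{\Gamma}$ means $o^-(\alpha+\gamma)=o^-(\beta+\gamma)$ for all $\gamma\in\Gamma$. The misère monoid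 $\mathcal{M}_{\Gamma}$ is the commutative monoid of $\equiv$-classes of $\Gamma$ with operation induced by disjunctive sum and identity the class of $0$, equipped with the outcome tetrapartition assigning each class the (common) misère outcome of its members. Two misère monoids are isomorphic if there is a monoid isomorphism between them which, together with its inverse, preserves the outcome of every element. $\mathcal{M}_{\mathrm{cl}( * )}$ has exactly two elements $1$ (class of $0$, outcome $\mathcal{N}$) and $a$ (class of $*$, outcome $\mathcal{P}$) with $a^2=1$. *)

theory Defs
  imports "HOL-Algebra.Group" "HOL-Library.FSet"
begin

text \<open>Positions are identified only when they have the same game tree; they are not taken
  modulo any notion of equality of values.\<close>

datatype position = Position (left_opts: "position fset") (right_opts: "position fset")

lemma size_left_option: "x |\<in>| left_opts \<alpha> \<Longrightarrow> size x < size \<alpha>"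
proof (cases \<alpha>)
  case (Position A B)
  assume "x |\<in>| left_opts \<alpha>"
  then have "Suc (size x) \<le> (\<Sum>y\<in>fset A. Suc (size y))"
    using Position by (intro member_le_sum[of x "fset A" "\<lambda>y. Suc (size y)"]) auto
  then show ?thesis using Position by simp
qed

lemma size_right_option: "x |\<in>| right_opts \<alpha> \<Longrightarrow> size x < size \<alpha>"
proof (cases \<alpha>)
  case (Position A B)
  assume "x |\<in>| right_opts \<alpha>"
  then have "Suc (size x) \<le> (\<Sum>y\<in>fset B. Suc (size y))"
    using Position by (intro member_le_sum[of x "fset B" "\<lambda>y. Suc (size y)"]) auto
  then show ?thesis using Position by simp
qed

declare fimage_cong [fundef_cong]

instantiation position :: "{zero, plus}"
begin

definition zero_position :: position where
  "0 = Position {||} {||}"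

function plus_position :: "position \<Rightarrow> position \<Rightarrow> position" where
  "plus_position \<alpha> \<beta> = Position
     ((\<lambda>x. plus_position x \<beta>) |`| left_opts \<alpha> |\<union>| (\<lambda>y. plus_position \<alpha> y) |`| left_opts \<beta>)
     ((\<lambda>x. plus_position x \<beta>) |`| right_opts \<alpha> |\<union>| (\<lambda>y. plus_position \<alpha> y) |`| right_opts \<beta>)"
  by pat_completeness auto
termination
  by (relation "measure (\<lambda>(\<alpha>, \<beta>). size \<alpha> + size \<beta>)")
     (auto simp: size_left_option size_right_option)

instance ..

end

declare plus_position.simps [simp del]

definition star :: position where
  "star = Position {|0|} {|0|}"


datatype player = Left | Right

fun opponent :: "player \<Rightarrow> player" where
  "opponent Left = Right"
| "opponent Right = Left"

fun options :: "player \<Rightarrow> position \<Rightarrow> position fset" where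
  "options Left \<xi> = left_opts \<xi>"
| "options Right \<xi> = right_opts \<xi>"

lemma size_option: "x |\<in>| options p \<xi> \<Longrightarrow> size x < size \<xi>"
  by (cases p) (auto simp: size_left_option size_right_option)

text \<open>\<open>wins_first p \<xi>\<close>: player \<open>p\<close> wins the misere play of \<open>\<xi>\<close> when \<open>p\<close> moves first.
  Play is finite and never drawn, so \<open>p\<close> wins moving second iff the opponent does not win
  moving first.\<close>

function wins_first :: "player \<Rightarrow> position \<Rightarrow> bool" where
  "wins_first p \<xi> \<longleftrightarrow>
     options p \<xi> = {||} \<or> fBex (options p \<xi>) (\<lambda>x. \<not> wins_first (opponent p) x)"
  by pat_completeness auto
termination
  by (relation "measure (\<lambda>(p, \<xi>). size \<xi>)") (auto simp: size_option)

declare wins_first.simps [simp del]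

definition wins_second :: "player \<Rightarrow> position \<Rightarrow> bool" where
  "wins_second p \<xi> \<longleftrightarrow> \<not> wins_first (opponent p) \<xi>"

datatype outcome = \<L> | \<R> | \<N> | \<P>

definition misere_outcome :: "position \<Rightarrow> outcome" where
  "misere_outcome \<xi> =
     (if wins_first Left \<xi> \<and> wins_second Left \<xi> then \<L>
      else if wins_first Right \<xi> \<and> wins_second Right \<xi> then \<R>
      else if wins_first Left \<xi> \<and> wins_first Right \<xi> then \<N>
      else \<P>)"

lemma misere_outcome_iff:
  "misere_outcome \<xi> = \<L> \<longleftrightarrow> wins_first Left \<xi> \<and> wins_second Left \<xi>"
  "misere_outcome \<xi> = \<R> \<longleftrightarrow> wins_first Right \<xi> \<and> wins_second Right \<xi>"
  "misere_outcome \<xi> = \<N> \<longleftrightarrow> wins_first Left \<xi> \<and> wins_first Right \<xi>"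
  "misere_outcome \<xi> = \<P> \<longleftrightarrow> wins_second Left \<xi> \<and> wins_second Right \<xi>"
  by (auto simp: misere_outcome_def wins_second_def)


definition closed_positions :: "position set \<Rightarrow> bool" where
  "closed_positions \<Gamma> \<longleftrightarrow>
     (\<forall>\<alpha>\<in>\<Gamma>. \<forall>\<beta>\<in>\<Gamma>. \<alpha> + \<beta> \<in> \<Gamma>) \<and>
     (\<forall>\<alpha>\<in>\<Gamma>. fset (left_opts \<alpha>) \<subseteq> \<Gamma> \<and> fset (right_opts \<alpha>) \<subseteq> \<Gamma>)"

definition cl :: "position set \<Rightarrow> position set" where
  "cl \<Upsilon> = \<Inter>{\<Gamma>. closed_positions \<Gamma> \<and> \<Upsilon> \<subseteq> \<Gamma>}"

lemma closed_positions_cl: "closed_positions (cl \<Upsilon>)"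
  unfolding cl_def closed_positions_def by blast

lemma subset_cl: "\<Upsilon> \<subseteq> cl \<Upsilon>"
  unfolding cl_def by blast

lemma cl_least: "closed_positions \<Gamma> \<Longrightarrow> \<Upsilon> \<subseteq> \<Gamma> \<Longrightarrow> cl \<Upsilon> \<subseteq> \<Gamma>"
  unfolding cl_def by blast


definition misere_equiv :: "position set \<Rightarrow> (position \<times> position) set" where
  "misere_equiv \<Gamma> = {(\<alpha>, \<beta>). \<alpha> \<in> \<Gamma> \<and> \<beta> \<in> \<Gamma> \<and>
     (\<forall>\<gamma>\<in>\<Gamma>. misere_outcome (\<alpha> + \<gamma>) = misere_outcome (\<beta> + \<gamma>))}"

record 'a outcome_monoid = "'a monoid" +
  tetrapartition :: "'a \<Rightarrow> outcome"

definition misere_monoid :: "position set \<Rightarrow> position set outcome_monoid" where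
  "misere_monoid \<Gamma> =
     \<lparr>carrier = \<Gamma> // misere_equiv \<Gamma>,
      mult = (\<lambda>X Y. \<Union>\<alpha>\<in>X. \<Union>\<beta>\<in>Y. misere_equiv \<Gamma> `` {\<alpha> + \<beta>}),
      one = misere_equiv \<Gamma> `` {0},
      tetrapartition = (\<lambda>X. THE out. \<forall>\<xi>\<in>X. misere_outcome \<xi> = out)\<rparr>"

definition outcome_monoid_isomorphic ::
    "('a, 'c) outcome_monoid_scheme \<Rightarrow> ('b, 'd) outcome_monoid_scheme \<Rightarrow> bool" where
  "outcome_monoid_isomorphic M N \<longleftrightarrow>
     (\<exists>h\<in>iso M N. h \<one>\<^bsub>M\<^esub> = \<one>\<^bsub>N\<^esub> \<and>
        (\<forall>x\<in>carrier M. tetrapartition N (h x) = tetrapartition M x) \<and>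
        (\<forall>y\<in>carrier N. tetrapartition M (inv_into (carrier M) h y) = tetrapartition N y))"


text \<open>The operations of \<^const>\<open>misere_monoid\<close> are well defined on classes.\<close>

lemma options_plus:
  "left_opts (\<alpha> + \<beta>) = (\<lambda>x. x + \<beta>) |`| left_opts \<alpha> |\<union>| (\<lambda>y. \<alpha> + y) |`| left_opts \<beta>"
  "right_opts (\<alpha> + \<beta>) = (\<lambda>x. x + \<beta>) |`| right_opts \<alpha> |\<union>| (\<lambda>y. \<alpha> + y) |`| right_opts \<beta>"
  by (subst plus_position.simps, simp)+

lemma options_zero: "left_opts 0 = {||}" "right_opts 0 = {||}"
  by (simp_all add: zero_position_def)

lemma position_eqI:
  "left_opts \<alpha> = left_opts \<beta> \<Longrightarrow> right_opts \<alpha> = right_opts \<beta> \<Longrightarrow> \<alpha> = (\<beta> :: position)"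
  by (cases \<alpha>; cases \<beta>) simp

instance position :: comm_monoid_add
proof
  fix \<alpha> \<beta> \<gamma> :: position
  show "\<alpha> + \<beta> + \<gamma> = \<alpha> + (\<beta> + \<gamma>)"
  proof (induction "size \<alpha> + size \<beta> + size \<gamma>" arbitrary: \<alpha> \<beta> \<gamma> rule: less_induct)
    case less
    have "\<And>x. x |\<in>| left_opts \<alpha> \<or> x |\<in>| right_opts \<alpha> \<Longrightarrow> x + \<beta> + \<gamma> = x + (\<beta> + \<gamma>)"
      "\<And>x. x |\<in>| left_opts \<beta> \<or> x |\<in>| right_opts \<beta> \<Longrightarrow> \<alpha> + x + \<gamma> = \<alpha> + (x + \<gamma>)"
      "\<And>x. x |\<in>| left_opts \<gamma> \<or> x |\<in>| right_opts \<gamma> \<Longrightarrow> \<alpha> + \<beta> + x = \<alpha> + (\<beta> + x)"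
      by (rule less, use size_left_option size_right_option in force)+
    then show ?case
      by (intro position_eqI)
         (simp_all add: options_plus fimage_funion fset.map_comp comp_def funion_assoc
            cong: fimage_cong)
  qed
  show "\<alpha> + \<beta> = \<beta> + \<alpha>"
  proof (induction "size \<alpha> + size \<beta>" arbitrary: \<alpha> \<beta> rule: less_induct)
    case less
    have "x + \<beta> = \<beta> + x" if "x |\<in>| left_opts \<alpha> \<or> x |\<in>| right_opts \<alpha>" for x
      by (rule less) (use that size_left_option size_right_option in force)
    then have A: "(\<lambda>x. x + \<beta>) |`| left_opts \<alpha> = (\<lambda>x. \<beta> + x) |`| left_opts \<alpha>"
      "(\<lambda>x. x + \<beta>) |`| right_opts \<alpha> = (\<lambda>x. \<beta> + x) |`| right_opts \<alpha>"
      by (simp_all cong: fimage_cong)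
    have "\<alpha> + x = x + \<alpha>" if "x |\<in>| left_opts \<beta> \<or> x |\<in>| right_opts \<beta>" for x
      by (rule less) (use that size_left_option size_right_option in force)
    then have B: "(\<lambda>x. \<alpha> + x) |`| left_opts \<beta> = (\<lambda>x. x + \<alpha>) |`| left_opts \<beta>"
      "(\<lambda>x. \<alpha> + x) |`| right_opts \<beta> = (\<lambda>x. x + \<alpha>) |`| right_opts \<beta>"
      by (simp_all cong: fimage_cong)
    show ?case
      by (rule position_eqI; simp only: options_plus A B) (rule funion_commute)+
  qed
  show "0 + \<alpha> = \<alpha>"
  proof (induction "size \<alpha>" arbitrary: \<alpha> rule: less_induct)
    case less
    have "\<And>x. x |\<in>| left_opts \<alpha> \<or> x |\<in>| right_opts \<alpha> \<Longrightarrow> 0 + x = x"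
      by (rule less, use size_left_option size_right_option in force)
    then show ?case
      by (intro position_eqI)
         (simp_all add: options_plus options_zero cong: fimage_cong)
  qed
qed

lemma zero_in_closed:
  assumes "closed_positions \<Gamma>" "\<Gamma> \<noteq> {}"
  shows "0 \<in> \<Gamma>"
proof -
  have "\<alpha> \<in> \<Gamma> \<Longrightarrow> 0 \<in> \<Gamma>" for \<alpha>
  proof (induction "size \<alpha>" arbitrary: \<alpha> rule: less_induct)
    case less
    show ?case
    proof (cases "\<alpha> = 0")
      case False
      then obtain x where x: "x |\<in>| left_opts \<alpha> \<or> x |\<in>| right_opts \<alpha>"
        by (cases \<alpha>) (auto simp: zero_position_def)
      then have "x \<in> \<Gamma>" using assms less.prems by (auto simp: closed_positions_def)
      moreover have "size x < size \<alpha>" using x size_left_option size_right_option by blast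
      ultimately show ?thesis using less.hyps by blast
    qed (use less in simp)
  qed
  then show ?thesis using assms by blast
qed

lemma equiv_misere_equiv: "equiv \<Gamma> (misere_equiv \<Gamma>)"
  by (rule equivI) (auto simp: misere_equiv_def refl_on_def sym_on_def trans_on_def)

lemma misere_equiv_plus:
  assumes "closed_positions \<Gamma>" "(\<alpha>, \<alpha>') \<in> misere_equiv \<Gamma>" "(\<beta>, \<beta>') \<in> misere_equiv \<Gamma>"
  shows "(\<alpha> + \<beta>, \<alpha>' + \<beta>') \<in> misere_equiv \<Gamma>"
proof -
  have mem: "\<alpha> \<in> \<Gamma>" "\<alpha>' \<in> \<Gamma>" "\<beta> \<in> \<Gamma>" "\<beta>' \<in> \<Gamma>"
    using assms by (auto simp: misere_equiv_def)
  have "misere_outcome (\<alpha> + \<beta> + \<gamma>) = misere_outcome (\<alpha>' + \<beta>' + \<gamma>)" if "\<gamma> \<in> \<Gamma>" for \<gamma>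
  proof -
    have "misere_outcome (\<alpha> + (\<beta> + \<gamma>)) = misere_outcome (\<alpha>' + (\<beta> + \<gamma>))"
      using assms mem that by (auto simp: misere_equiv_def closed_positions_def)
    moreover have "misere_outcome (\<beta> + (\<alpha>' + \<gamma>)) = misere_outcome (\<beta>' + (\<alpha>' + \<gamma>))"
      using assms mem that by (auto simp: misere_equiv_def closed_positions_def)
    ultimately show ?thesis by (simp add: ac_simps)
  qed
  then show ?thesis
    using assms mem by (auto simp: misere_equiv_def closed_positions_def)
qed

lemma carrier_misere_monoid:
  "X \<in> carrier (misere_monoid \<Gamma>) \<longleftrightarrow> (\<exists>\<alpha>\<in>\<Gamma>. X = misere_equiv \<Gamma> `` {\<alpha>})"
  by (auto simp: misere_monoid_def quotient_def)

lemma mult_misere_monoid: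
  assumes "closed_positions \<Gamma>" "\<alpha> \<in> \<Gamma>" "\<beta> \<in> \<Gamma>"
  shows "misere_equiv \<Gamma> `` {\<alpha>} \<otimes>\<^bsub>misere_monoid \<Gamma>\<^esub> misere_equiv \<Gamma> `` {\<beta>}
       = misere_equiv \<Gamma> `` {\<alpha> + \<beta>}"
proof -
  have "misere_equiv \<Gamma> `` {\<alpha>' + \<beta>'} = misere_equiv \<Gamma> `` {\<alpha> + \<beta>}"
    if "(\<alpha>, \<alpha>') \<in> misere_equiv \<Gamma>" "(\<beta>, \<beta>') \<in> misere_equiv \<Gamma>" for \<alpha>' \<beta>'
    using equiv_class_eq[OF equiv_misere_equiv misere_equiv_plus[OF assms(1) that]] by simp
  moreover have "(\<alpha>, \<alpha>) \<in> misere_equiv \<Gamma>" "(\<beta>, \<beta>) \<in> misere_equiv \<Gamma>"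
    using assms by (auto simp: misere_equiv_def)
  ultimately have "(\<Union>\<alpha>'\<in>misere_equiv \<Gamma> `` {\<alpha>}. \<Union>\<beta>'\<in>misere_equiv \<Gamma> `` {\<beta>}.
      misere_equiv \<Gamma> `` {\<alpha>' + \<beta>'}) = misere_equiv \<Gamma> `` {\<alpha> + \<beta>}"
    by blast
  then show ?thesis
    by (simp add: misere_monoid_def)
qed

lemma tetrapartition_misere_monoid:
  assumes "closed_positions \<Gamma>" "\<alpha> \<in> \<Gamma>"
  shows "tetrapartition (misere_monoid \<Gamma>) (misere_equiv \<Gamma> `` {\<alpha>}) = misere_outcome \<alpha>"
proof -
  have "0 \<in> \<Gamma>" using assms zero_in_closed by blast
  then have "misere_outcome \<xi> = misere_outcome \<alpha>" if "(\<alpha>, \<xi>) \<in> misere_equiv \<Gamma>" for \<xi>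
    using that bspec[of \<Gamma> "\<lambda>\<gamma>. misere_outcome (\<alpha> + \<gamma>) = misere_outcome (\<xi> + \<gamma>)" 0]
    by (simp add: misere_equiv_def)
  moreover have "(\<alpha>, \<alpha>) \<in> misere_equiv \<Gamma>"
    using assms by (auto simp: misere_equiv_def)
  ultimately have "(THE out. \<forall>\<xi>\<in>misere_equiv \<Gamma> `` {\<alpha>}. misere_outcome \<xi> = out) = misere_outcome \<alpha>"
    by (intro the_equality) (blast, metis Image_singleton_iff)
  then show ?thesis
    by (simp add: misere_monoid_def)
qed

lemma comm_monoid_misere_monoid:
  assumes "closed_positions \<Gamma>" "\<Gamma> \<noteq> {}"
  shows "comm_monoid (misere_monoid \<Gamma>)"
proof -
  have plus: "\<alpha> + \<beta> \<in> \<Gamma>" if "\<alpha> \<in> \<Gamma>" "\<beta> \<in> \<Gamma>" for \<alpha> \<beta>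
    using assms that by (auto simp: closed_positions_def)
  have one: "\<one>\<^bsub>misere_monoid \<Gamma>\<^esub> = misere_equiv \<Gamma> `` {0}"
    by (simp add: misere_monoid_def)
  have zero: "0 \<in> \<Gamma>" using assms by (rule zero_in_closed)
  note [simp] = carrier_misere_monoid one mult_misere_monoid[OF assms(1)] plus zero
  show ?thesis
  proof (rule comm_monoidI)
    fix X Y
    assume "X \<in> carrier (misere_monoid \<Gamma>)" "Y \<in> carrier (misere_monoid \<Gamma>)"
    then obtain \<alpha> \<beta> where X: "\<alpha> \<in> \<Gamma>" "X = misere_equiv \<Gamma> `` {\<alpha>}"
      and Y: "\<beta> \<in> \<Gamma>" "Y = misere_equiv \<Gamma> `` {\<beta>}" by auto
    show "X \<otimes>\<^bsub>misere_monoid \<Gamma>\<^esub> Y \<in> carrier (misere_monoid \<Gamma>)"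
      using X Y plus[of \<alpha> \<beta>] by (simp del: plus) blast
    show "X \<otimes>\<^bsub>misere_monoid \<Gamma>\<^esub> Y = Y \<otimes>\<^bsub>misere_monoid \<Gamma>\<^esub> X"
      using X Y by (simp add: add.commute)
    show "\<one>\<^bsub>misere_monoid \<Gamma>\<^esub> \<otimes>\<^bsub>misere_monoid \<Gamma>\<^esub> X = X"
      using X by simp
    fix Z
    assume "Z \<in> carrier (misere_monoid \<Gamma>)"
    then obtain \<gamma> where Z: "\<gamma> \<in> \<Gamma>" "Z = misere_equiv \<Gamma> `` {\<gamma>}" by auto
    show "X \<otimes>\<^bsub>misere_monoid \<Gamma>\<^esub> Y \<otimes>\<^bsub>misere_monoid \<Gamma>\<^esub> Z
        = X \<otimes>\<^bsub>misere_monoid \<Gamma>\<^esub> (Y \<otimes>\<^bsub>misere_monoid \<Gamma>\<^esub> Z)"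
      using X Y Z by (simp add: add.assoc)
  next
    show "\<one>\<^bsub>misere_monoid \<Gamma>\<^esub> \<in> carrier (misere_monoid \<Gamma>)"
      using zero by (simp del: zero) blast
  qed
qed

end

theory Submission
  imports Defs
begin

text \<open>Under (2) and (3) every move in the closure switches between outcome \<open>\<N>\<close> and outcome
  \<open>\<P>\<close>, and every \<open>\<P>\<close>-position has moves for both players. By induction a sum is then an
  \<open>\<N>\<close>-position iff its two summands have the same outcome, so the classes are exactly the outcomes
  and the monoid is \<open>\<int>/2\<close>. Conversely, an isomorphism makes all \<open>\<N>\<close>-positions equivalent to \<open>0\<close> and
  provides a \<open>\<P>\<close>-position \<open>\<pi>\<close>. If an \<open>\<N>\<close>-position \<open>\<xi>\<close> had an \<open>\<N>\<close>-option \<open>x\<close>, then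
  \<open>\<xi> + \<pi>\<close> and its option \<open>x + \<pi>\<close> would both be \<open>\<P>\<close>-positions, which is absurd.\<close>

section \<open>Recognising the outcomes \<N> and \<P> from the options\<close>

lemma options_plus_player:
  "options p (\<alpha> + \<beta>) = (\<lambda>x. x + \<beta>) |`| options p \<alpha> |\<union>| (\<lambda>y. \<alpha> + y) |`| options p \<beta>"
  by (cases p) (simp_all add: options_plus)

lemma outcome_\<N>_iff: "misere_outcome \<xi> = \<N> \<longleftrightarrow> (\<forall>p. wins_first p \<xi>)"
  by (metis misere_outcome_iff(3) player.exhaust)

lemma outcome_\<P>_iff: "misere_outcome \<xi> = \<P> \<longleftrightarrow> (\<forall>p. \<not> wins_first p \<xi>)"
  by (metis misere_outcome_iff(4) opponent.simps player.exhaust wins_second_def)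

lemma outcome_\<P>_options_nonempty: "misere_outcome \<xi> = \<P> \<Longrightarrow> options p \<xi> \<noteq> {||}"
  using wins_first.simps[of p \<xi>] by (auto simp: outcome_\<P>_iff)

text \<open>Moving to a \<P>-position wins, and from a \<P>-position no player wins moving
  first.\<close>

lemma outcome_\<P>_option:
  assumes "misere_outcome \<xi> = \<P>" "x |\<in>| options p \<xi>"
  shows "misere_outcome x \<noteq> \<P>"
  using assms wins_first.simps[of p \<xi>] by (auto simp: outcome_\<P>_iff)

text \<open>A player with a move hands the opponent a losing position, and a player with none wins
  by the misere rule. The hypothesis may thus hold vacuously, as it does for
  \<open>0\<close>.\<close>

lemma outcome_\<N>I:
  assumes "\<And>p x. x |\<in>| options p \<xi> \<Longrightarrow> misere_outcome x = \<P>"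
  shows "misere_outcome \<xi> = \<N>"
proof -
  have "wins_first p \<xi>" for p
  proof (cases "options p \<xi> = {||}")
    case False
    then obtain x where "x |\<in>| options p \<xi>" by auto
    then have "\<not> wins_first (opponent p) x" using assms by (simp add: outcome_\<P>_iff)
    then show ?thesis using \<open>x |\<in>| options p \<xi>\<close> by (subst wins_first.simps) blast
  qed (simp add: wins_first.simps[of p \<xi>])
  then show ?thesis by (simp add: outcome_\<N>_iff)
qed

text \<open>Nonemptiness is asked of each player separately, since in misere play a player without a
  move wins at once.\<close>

lemma outcome_\<P>I:
  assumes "\<And>p. options p \<xi> \<noteq> {||}"
    and "\<And>p x. x |\<in>| options p \<xi> \<Longrightarrow> misere_outcome x = \<N>"
  shows "misere_outcome \<xi> = \<P>"
proof -
  have "\<not> wins_first p \<xi>" for p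
    using assms by (subst wins_first.simps) (auto simp: outcome_\<N>_iff)
  then show ?thesis by (simp add: outcome_\<P>_iff)
qed

lemma outcome_zero: "misere_outcome 0 = \<N>"
proof (rule outcome_\<N>I)
  show "misere_outcome x = \<P>" if "x |\<in>| options p 0" for p x
    using that by (cases p) (simp_all add: options_zero)
qed

lemma nonzero_has_option:
  assumes "\<xi> \<noteq> 0"
  obtains p x where "x |\<in>| options p \<xi>"
proof -
  from assms have "left_opts \<xi> \<noteq> {||} \<or> right_opts \<xi> \<noteq> {||}"
    by (metis options_zero position_eqI)
  then show thesis
    using that[of _ Left] that[of _ Right] by auto
qed

section \<open>Closed sets in which moves alternate between \<N> and \<P>\<close>

lemma closed_plus: "closed_positions \<Gamma> \<Longrightarrow> \<alpha> \<in> \<Gamma> \<Longrightarrow> \<beta> \<in> \<Gamma> \<Longrightarrow> \<alpha> + \<beta> \<in> \<Gamma>"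
  by (simp add: closed_positions_def)

lemma closed_option: "closed_positions \<Gamma> \<Longrightarrow> \<xi> \<in> \<Gamma> \<Longrightarrow> x |\<in>| options p \<xi> \<Longrightarrow> x \<in> \<Gamma>"
  by (cases p) (auto simp: closed_positions_def)

text \<open>\<open>{0}\<close> is itself closed, as \<open>0 + 0 = 0\<close> and \<open>0\<close>
  has no options. Hence a nonzero position in the closure forces one among the generators, which is
  condition (1).\<close>

lemma cl_trivial: "\<Upsilon> \<subseteq> {0} \<Longrightarrow> cl \<Upsilon> \<subseteq> {0}"
  by (rule cl_least) (auto simp: closed_positions_def options_zero)

text \<open>Conditions (2) and (3) are packaged as a locale because they are applied to two sets,
  \<open>cl \<Upsilon>\<close> and \<open>cl {star}\<close>.\<close>

locale alternating =
  fixes \<Gamma> :: "position set"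
  assumes closed: "closed_positions \<Gamma>"
    and outcome_\<N>_or_\<P>: "\<xi> \<in> \<Gamma> \<Longrightarrow> misere_outcome \<xi> \<in> {\<N>, \<P>}"
    and \<N>_option: "\<xi> \<in> \<Gamma> \<Longrightarrow> misere_outcome \<xi> = \<N> \<Longrightarrow> x |\<in>| options p \<xi> \<Longrightarrow> misere_outcome x = \<P>"
begin

text \<open>From \<N> to \<P> this is \<open>\<N>_option\<close>. From \<P>, an option cannot be
  \<P>, so it is \<N>, the only other outcome in \<Gamma>.\<close>

lemma option_switches:
  assumes "\<xi> \<in> \<Gamma>" "x |\<in>| options p \<xi>"
  shows "misere_outcome x = \<N> \<longleftrightarrow> misere_outcome \<xi> \<noteq> \<N>"
  using assms outcome_\<N>_or_\<P>[of \<xi>] outcome_\<N>_or_\<P>[of x] \<N>_option[of \<xi> x p]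
    outcome_\<P>_option[of \<xi> x p] closed_option[OF closed, of \<xi> x p] by auto

text \<open>A move in the sum changes exactly one summand and switches its outcome, so it toggles
  whether the two outcomes agree. The induction hypothesis then fixes the outcome of every option of
  the sum.\<close>

lemma outcome_plus:
  assumes "\<alpha> \<in> \<Gamma>" "\<beta> \<in> \<Gamma>"
  shows "misere_outcome (\<alpha> + \<beta>) = \<N> \<longleftrightarrow> misere_outcome \<alpha> = misere_outcome \<beta>"
  using assms
proof (induction "size \<alpha> + size \<beta>" arbitrary: \<alpha> \<beta> rule: less_induct)
  case less
  have opt: "misere_outcome z = \<N> \<longleftrightarrow> misere_outcome \<alpha> \<noteq> misere_outcome \<beta>"
    if z: "z |\<in>| options p (\<alpha> + \<beta>)" for p z
  proof -
    from z consider x where "x |\<in>| options p \<alpha>" "z = x + \<beta>" | y where "y |\<in>| options p \<beta>" "z = \<alpha> + y"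
      by (auto simp: options_plus_player)
    then show ?thesis
    proof cases
      case 1
      then have x: "x \<in> \<Gamma>" using closed_option[OF closed] less.prems by blast
      have "misere_outcome (x + \<beta>) = \<N> \<longleftrightarrow> misere_outcome x = misere_outcome \<beta>"
        using less.hyps[of x \<beta>] size_option[OF 1(1)] x less.prems by simp
      then show ?thesis
        using 1 option_switches[OF less.prems(1) 1(1)] outcome_\<N>_or_\<P>[OF x]
          outcome_\<N>_or_\<P>[OF less.prems(1)] outcome_\<N>_or_\<P>[OF less.prems(2)] by auto
    next
      case 2
      then have y: "y \<in> \<Gamma>" using closed_option[OF closed] less.prems by blast
      have "misere_outcome (\<alpha> + y) = \<N> \<longleftrightarrow> misere_outcome \<alpha> = misere_outcome y"
        using less.hyps[of \<alpha> y] size_option[OF 2(1)] y less.prems by simp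
      then show ?thesis
        using 2 option_switches[OF less.prems(2) 2(1)] outcome_\<N>_or_\<P>[OF y]
          outcome_\<N>_or_\<P>[OF less.prems(1)] outcome_\<N>_or_\<P>[OF less.prems(2)] by auto
    qed
  qed
  have sum: "\<alpha> + \<beta> \<in> \<Gamma>" using closed_plus[OF closed] less.prems by blast
  show ?case
  proof (cases "misere_outcome \<alpha> = misere_outcome \<beta>")
    case True
    have "misere_outcome (\<alpha> + \<beta>) = \<N>"
    proof (rule outcome_\<N>I)
      show "misere_outcome z = \<P>" if "z |\<in>| options p (\<alpha> + \<beta>)" for p z
        using opt[OF that] True outcome_\<N>_or_\<P>[OF closed_option[OF closed sum that]] by auto
    qed
    then show ?thesis using True by simp
  next
    case False
    have "misere_outcome (\<alpha> + \<beta>) = \<P>"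
    proof (rule outcome_\<P>I)
      \<comment> \<open>When the outcomes differ, one summand is a \<P>-position, and it gives both
        players a move in the sum.\<close>
      from False have "misere_outcome \<alpha> = \<P> \<or> misere_outcome \<beta> = \<P>"
        using outcome_\<N>_or_\<P>[OF less.prems(1)] outcome_\<N>_or_\<P>[OF less.prems(2)] by auto
      then show "options p (\<alpha> + \<beta>) \<noteq> {||}" for p
        using outcome_\<P>_options_nonempty[of \<alpha> p] outcome_\<P>_options_nonempty[of \<beta> p]
        by (auto simp: options_plus_player)
      show "misere_outcome z = \<N>" if "z |\<in>| options p (\<alpha> + \<beta>)" for p z
        using opt[OF that] False by simp
    qed
    then show ?thesis using False by simp
  qed
qed

text \<open>By \<open>outcome_plus\<close>, the outcome of a sum depends only on the outcomes of the
  summands. Conversely, adding \<open>0\<close> as test position separates different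
  outcomes.\<close>

lemma misere_class:
  assumes "\<alpha> \<in> \<Gamma>"
  shows "misere_equiv \<Gamma> `` {\<alpha>} = {\<beta> \<in> \<Gamma>. misere_outcome \<beta> = misere_outcome \<alpha>}"
proof -
  have "misere_outcome (\<alpha> + \<gamma>) = misere_outcome (\<beta> + \<gamma>)"
    if "\<beta> \<in> \<Gamma>" "\<gamma> \<in> \<Gamma>" "misere_outcome \<beta> = misere_outcome \<alpha>" for \<beta> \<gamma>
    using that assms outcome_plus[of \<alpha> \<gamma>] outcome_plus[of \<beta> \<gamma>]
      outcome_\<N>_or_\<P>[OF closed_plus[OF closed, of \<alpha> \<gamma>]]
      outcome_\<N>_or_\<P>[OF closed_plus[OF closed, of \<beta> \<gamma>]] by auto
  moreover have "misere_outcome \<beta> = misere_outcome \<alpha>" if "(\<alpha>, \<beta>) \<in> misere_equiv \<Gamma>" for \<beta>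
  proof -
    have "0 \<in> \<Gamma>" using zero_in_closed[OF closed] assms by blast
    then have "misere_outcome (\<alpha> + 0) = misere_outcome (\<beta> + 0)"
      using that unfolding misere_equiv_def by blast
    then show ?thesis by simp
  qed
  ultimately have "(\<alpha>, \<beta>) \<in> misere_equiv \<Gamma> \<longleftrightarrow> \<beta> \<in> \<Gamma> \<and> misere_outcome \<beta> = misere_outcome \<alpha>" for \<beta>
    using assms unfolding misere_equiv_def by blast
  then show ?thesis by blast
qed

text \<open>A nonzero position either has outcome \<P> itself or is an \<N>-position with an option,
  and that option is \<P>.\<close>

lemma exists_\<P>:
  assumes "\<xi> \<in> \<Gamma>" "\<xi> \<noteq> 0"
  shows "\<exists>\<pi>\<in>\<Gamma>. misere_outcome \<pi> = \<P>"
proof (cases "misere_outcome \<xi> = \<N>")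
  case True
  from assms(2) obtain p x where "x |\<in>| options p \<xi>" by (rule nonzero_has_option)
  then show ?thesis using \<N>_option[OF assms(1) True] closed_option[OF closed assms(1)] by blast
next
  case False
  then show ?thesis using outcome_\<N>_or_\<P>[OF assms(1)] assms(1) by auto
qed

end

section \<open>The isomorphism that matches classes by outcome\<close>

lemma alternating_isomorphic:
  assumes "alternating \<Gamma>" "\<pi> \<in> \<Gamma>" "misere_outcome \<pi> = \<P>"
    and "alternating \<Delta>" "\<rho> \<in> \<Delta>" "misere_outcome \<rho> = \<P>"
  shows "outcome_monoid_isomorphic (misere_monoid \<Gamma>) (misere_monoid \<Delta>)"
proof -
  interpret G: alternating \<Gamma> by fact
  interpret D: alternating \<Delta> by fact
  let ?M = "misere_monoid \<Gamma>" and ?N = "misere_monoid \<Delta>"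
  \<comment> \<open>Defining \<open>h\<close> through the outcome of a class avoids choosing
    representatives. By \<open>D.misere_class\<close> the value is a class of \<Delta> as soon as
    that outcome occurs in \<Delta>.\<close>
  define h where "h X = {\<delta> \<in> \<Delta>. misere_outcome \<delta> = tetrapartition ?M X}" for X
  have zero: "0 \<in> \<Gamma>" "0 \<in> \<Delta>"
    using zero_in_closed G.closed D.closed assms by blast+
  have h: "h (misere_equiv \<Gamma> `` {\<alpha>}) = misere_equiv \<Delta> `` {\<delta>}"
    if "\<alpha> \<in> \<Gamma>" "\<delta> \<in> \<Delta>" "misere_outcome \<alpha> = misere_outcome \<delta>" for \<alpha> \<delta>
    using that by (simp add: h_def tetrapartition_misere_monoid[OF G.closed] D.misere_class)
  \<comment> \<open>Outcome \<N> is realised in \<Delta> by \<open>0\<close> and outcome \<P> by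
    \<rho>; in \<Gamma>, \<pi> takes the role of \<rho>.\<close>
  have G_to_D: "\<exists>\<delta>\<in>\<Delta>. misere_outcome \<alpha> = misere_outcome \<delta>" if "\<alpha> \<in> \<Gamma>" for \<alpha>
    using G.outcome_\<N>_or_\<P>[OF that] zero assms outcome_zero by force
  have D_to_G: "\<exists>\<alpha>\<in>\<Gamma>. misere_outcome \<alpha> = misere_outcome \<delta>" if "\<delta> \<in> \<Delta>" for \<delta>
    using D.outcome_\<N>_or_\<P>[OF that] zero assms outcome_zero by force
  have h_tetra: "tetrapartition ?N (h X) = tetrapartition ?M X" if X: "X \<in> carrier ?M" for X
  proof -
    obtain \<alpha> where a: "\<alpha> \<in> \<Gamma>" "X = misere_equiv \<Gamma> `` {\<alpha>}"
      using X by (auto simp: carrier_misere_monoid)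
    obtain \<delta> where "\<delta> \<in> \<Delta>" "misere_outcome \<alpha> = misere_outcome \<delta>" using G_to_D[OF a(1)] by blast
    then show ?thesis
      using a by (simp add: h tetrapartition_misere_monoid[OF G.closed] tetrapartition_misere_monoid[OF D.closed])
  qed
  have h_carrier: "h X \<in> carrier ?N" if X: "X \<in> carrier ?M" for X
    using X G_to_D h unfolding carrier_misere_monoid by metis
  have inj: "inj_on h (carrier ?M)"
  proof (rule inj_onI)
    fix X Y assume XY: "X \<in> carrier ?M" "Y \<in> carrier ?M" "h X = h Y"
    then have "tetrapartition ?M X = tetrapartition ?M Y" using h_tetra by metis
    moreover obtain \<alpha> \<beta> where "\<alpha> \<in> \<Gamma>" "X = misere_equiv \<Gamma> `` {\<alpha>}"
      and "\<beta> \<in> \<Gamma>" "Y = misere_equiv \<Gamma> `` {\<beta>}" using XY by (auto simp: carrier_misere_monoid)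
    ultimately have "\<alpha> \<in> \<Gamma>" "\<beta> \<in> \<Gamma>" "misere_outcome \<alpha> = misere_outcome \<beta>"
      using tetrapartition_misere_monoid[OF G.closed] by auto
    with \<open>X = _\<close> \<open>Y = _\<close> show "X = Y" by (simp add: G.misere_class)
  qed
  have surj: "h ` carrier ?M = carrier ?N"
  proof
    show "h ` carrier ?M \<subseteq> carrier ?N" using h_carrier by blast
    show "carrier ?N \<subseteq> h ` carrier ?M"
    proof
      fix Y assume "Y \<in> carrier ?N"
      then obtain \<delta> where d: "\<delta> \<in> \<Delta>" "Y = misere_equiv \<Delta> `` {\<delta>}"
        by (auto simp: carrier_misere_monoid)
      then obtain \<alpha> where a: "\<alpha> \<in> \<Gamma>" "misere_outcome \<alpha> = misere_outcome \<delta>" using D_to_G by blast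
      then have "misere_equiv \<Gamma> `` {\<alpha>} \<in> carrier ?M" by (auto simp: carrier_misere_monoid)
      with h[OF a(1) d(1) a(2)] d(2) show "Y \<in> h ` carrier ?M" by (metis imageI)
    qed
  qed
  have "h \<in> hom ?M ?N"
  proof (rule homI)
    fix X Y assume "X \<in> carrier ?M" "Y \<in> carrier ?M"
    then obtain \<alpha> \<beta> where X: "\<alpha> \<in> \<Gamma>" "X = misere_equiv \<Gamma> `` {\<alpha>}"
      and Y: "\<beta> \<in> \<Gamma>" "Y = misere_equiv \<Gamma> `` {\<beta>}" by (auto simp: carrier_misere_monoid)
    obtain \<gamma> \<delta> where c: "\<gamma> \<in> \<Delta>" "misere_outcome \<alpha> = misere_outcome \<gamma>"
      and d: "\<delta> \<in> \<Delta>" "misere_outcome \<beta> = misere_outcome \<delta>"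
      using G_to_D X(1) Y(1) by meson
    have sums: "\<alpha> + \<beta> \<in> \<Gamma>" "\<gamma> + \<delta> \<in> \<Delta>"
      using closed_plus G.closed D.closed X Y c d by blast+
    have "misere_outcome (\<alpha> + \<beta>) = misere_outcome (\<gamma> + \<delta>)"
      using G.outcome_plus[OF X(1) Y(1)] D.outcome_plus[OF c(1) d(1)] c d
        G.outcome_\<N>_or_\<P>[OF sums(1)] D.outcome_\<N>_or_\<P>[OF sums(2)] by auto
    then show "h (X \<otimes>\<^bsub>?M\<^esub> Y) = h X \<otimes>\<^bsub>?N\<^esub> h Y"
      using X Y c d sums
      by (simp add: h mult_misere_monoid[OF G.closed] mult_misere_monoid[OF D.closed])
  qed (rule h_carrier)
  then have "h \<in> iso ?M ?N"
    using inj surj by (simp add: iso_def bij_betw_def)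
  moreover have "h \<one>\<^bsub>?M\<^esub> = \<one>\<^bsub>?N\<^esub>"
    using h[OF zero] by (simp add: misere_monoid_def)
  moreover have "tetrapartition ?M (inv_into (carrier ?M) h Y) = tetrapartition ?N Y"
    if "Y \<in> carrier ?N" for Y
    using that surj h_tetra by (metis f_inv_into_f inv_into_into)
  ultimately show ?thesis
    using h_tetra unfolding outcome_monoid_isomorphic_def by blast
qed

section \<open>The closure of \<open>star\<close>\<close>

primrec stars :: "nat \<Rightarrow> position" where
  "stars 0 = 0"
| "stars (Suc n) = star + stars n"

text \<open>Every move turns one copy of \<open>star\<close> into \<open>0\<close>. All these moves
  lead to the same game tree, so the option set is a singleton.\<close>

lemma options_stars: "options p (stars n) = (if n = 0 then {||} else {|stars (n - 1)|})"
proof (induction n)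
  case 0
  show ?case by (cases p) (simp_all add: options_zero)
next
  case (Suc n)
  have "options p star = {|0|}" by (cases p) (simp_all add: star_def)
  then have "options p (stars (Suc n)) = finsert (stars n) ((+) star |`| options p (stars n))"
    by (simp add: options_plus_player)
  \<comment> \<open>For \<open>n = Suc m\<close>, moving inside \<open>stars n\<close> leaves
    \<open>star + stars m\<close>, which is \<open>stars n\<close> again.\<close>
  also have "\<dots> = {|stars n|}"
    unfolding Suc by (cases n) simp_all
  finally show ?case by simp
qed

lemma stars_add: "stars m + stars n = stars (m + n)"
  by (induction m) (simp_all add: add.assoc)

lemma outcome_stars: "misere_outcome (stars n) = (if even n then \<N> else \<P>)"
proof (induction n)
  case 0
  show ?case by (simp add: outcome_zero)
next
  case (Suc n)
  have opt: "options p (stars (Suc n)) = {|stars n|}" for p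
    by (simp only: options_stars) simp
  show ?case
  proof (cases "even n")
    case True
    then have "misere_outcome (stars (Suc n)) = \<P>"
      using Suc by (intro outcome_\<P>I) (simp_all only: opt, auto)
    then show ?thesis using True by simp
  next
    case False
    then have "misere_outcome (stars (Suc n)) = \<N>"
      using Suc by (intro outcome_\<N>I) (simp only: opt, auto)
    then show ?thesis using False by simp
  qed
qed

lemma closed_stars: "closed_positions (range stars)"
proof -
  have "fset (options p (stars n)) \<subseteq> range stars" for p n
    by (simp add: options_stars)
  from this[of Left] this[of Right] show ?thesis
    unfolding closed_positions_def options.simps by (auto simp: stars_add)
qed

text \<open>An inclusion suffices to transfer the outcome conditions of \<open>alternating\<close>,
  which are universal statements, from the multiples of \<open>star\<close> to the closure.\<close>

lemma cl_star: "cl {star} \<subseteq> range stars"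
proof (rule cl_least[OF closed_stars])
  show "{star} \<subseteq> range stars"
    using rangeI[of stars 1] by simp
qed

lemma star_in_cl: "star \<in> cl {star}"
  using subset_cl by blast

lemma outcome_star: "misere_outcome star = \<P>"
  using outcome_stars[of 1] by simp

lemma alternating_cl_star: "alternating (cl {star})"
proof
  show "closed_positions (cl {star})" by (rule closed_positions_cl)
  fix \<xi> assume "\<xi> \<in> cl {star}"
  then obtain n where n: "\<xi> = stars n" using cl_star by blast
  then show "misere_outcome \<xi> \<in> {\<N>, \<P>}" by (simp add: outcome_stars)
  fix x p assume "misere_outcome \<xi> = \<N>" "x |\<in>| options p \<xi>"
  then show "misere_outcome x = \<P>"
    using n by (auto simp: outcome_stars options_stars split: if_splits)
qed

section \<open>Conditions forced by an isomorphism\<close>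

lemma isomorphic_imp_alternating:
  assumes \<Gamma>: "closed_positions \<Gamma>"
    and iso: "outcome_monoid_isomorphic (misere_monoid \<Gamma>) (misere_monoid (cl {star}))"
  shows "alternating \<Gamma>" "\<exists>\<pi>\<in>\<Gamma>. misere_outcome \<pi> = \<P>"
proof -
  interpret S: alternating "cl {star}" by (rule alternating_cl_star)
  let ?M = "misere_monoid \<Gamma>" and ?N = "misere_monoid (cl {star})"
  from iso obtain h where bij: "bij_betw h (carrier ?M) (carrier ?N)"
    and h: "\<And>X. X \<in> carrier ?M \<Longrightarrow> tetrapartition ?N (h X) = tetrapartition ?M X"
    by (auto simp: outcome_monoid_isomorphic_def iso_def)
  have image: "\<exists>\<delta>\<in>cl {star}. h (misere_equiv \<Gamma> `` {\<alpha>}) = misere_equiv (cl {star}) `` {\<delta>} \<and>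
      misere_outcome \<delta> = misere_outcome \<alpha>" if a: "\<alpha> \<in> \<Gamma>" for \<alpha>
  proof -
    have X: "misere_equiv \<Gamma> `` {\<alpha>} \<in> carrier ?M" using a by (auto simp: carrier_misere_monoid)
    then have "h (misere_equiv \<Gamma> `` {\<alpha>}) \<in> carrier ?N" using bij by (rule bij_betw_apply[rotated])
    then show ?thesis
      using h[OF X] tetrapartition_misere_monoid[OF \<Gamma> a] tetrapartition_misere_monoid[OF S.closed]
      by (auto simp: carrier_misere_monoid)
  qed
  \<comment> \<open>Positions of equal outcome have images of equal outcome. In
    \<open>cl {star}\<close> the outcome determines the class, so the images coincide, and
    injectivity of \<open>h\<close> pulls this back to \<Gamma>.\<close>
  have equiv: "(\<alpha>, \<beta>) \<in> misere_equiv \<Gamma>"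
    if "\<alpha> \<in> \<Gamma>" "\<beta> \<in> \<Gamma>" "misere_outcome \<alpha> = misere_outcome \<beta>" for \<alpha> \<beta>
  proof -
    have "h (misere_equiv \<Gamma> `` {\<alpha>}) = h (misere_equiv \<Gamma> `` {\<beta>})"
      using image[OF that(1)] image[OF that(2)] that(3) S.misere_class by auto
    moreover have "misere_equiv \<Gamma> `` {\<alpha>} \<in> carrier ?M" "misere_equiv \<Gamma> `` {\<beta>} \<in> carrier ?M"
      using that by (auto simp: carrier_misere_monoid)
    ultimately have "misere_equiv \<Gamma> `` {\<alpha>} = misere_equiv \<Gamma> `` {\<beta>}"
      using bij by (auto simp: bij_betw_def dest: inj_onD)
    then show ?thesis
      using eq_equiv_class[OF _ equiv_misere_equiv] that by blast
  qed
  \<comment> \<open>The class of \<open>star\<close> has a preimage under the bijection, and a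
    representative of it is the required \<P>-position.\<close>
  have "misere_equiv (cl {star}) `` {star} \<in> carrier ?N"
    using star_in_cl by (auto simp: carrier_misere_monoid)
  then have "misere_equiv (cl {star}) `` {star} \<in> h ` carrier ?M"
    using bij by (simp add: bij_betw_def)
  then obtain \<pi> where \<pi>: "\<pi> \<in> \<Gamma>"
    and h\<pi>: "h (misere_equiv \<Gamma> `` {\<pi>}) = misere_equiv (cl {star}) `` {star}"
    by (auto simp: carrier_misere_monoid)
  have "misere_equiv \<Gamma> `` {\<pi>} \<in> carrier ?M" using \<pi> by (auto simp: carrier_misere_monoid)
  from h[OF this] have \<pi>_out: "misere_outcome \<pi> = \<P>"
    by (simp only: h\<pi> tetrapartition_misere_monoid[OF \<Gamma> \<pi>]
        tetrapartition_misere_monoid[OF S.closed star_in_cl] outcome_star)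
  then show "\<exists>\<pi>\<in>\<Gamma>. misere_outcome \<pi> = \<P>" using \<pi> by blast
  have zero: "0 \<in> \<Gamma>" using zero_in_closed[OF \<Gamma>] \<pi> by blast
  \<comment> \<open>As \<open>0\<close> is also an \<N>-position, \<xi> is equivalent to
    \<open>0\<close>, so \<open>\<xi> + \<pi>\<close> has the outcome of
    \<open>0 + \<pi> = \<pi>\<close>.\<close>
  have plus_\<pi>: "misere_outcome (\<xi> + \<pi>) = \<P>" if "\<xi> \<in> \<Gamma>" "misere_outcome \<xi> = \<N>" for \<xi>
    using equiv[OF that(1) zero] that \<pi> \<pi>_out outcome_zero by (auto simp: misere_equiv_def)
  show "alternating \<Gamma>"
  proof
    show "closed_positions \<Gamma>" by (rule \<Gamma>)
    show NP: "misere_outcome \<xi> \<in> {\<N>, \<P>}" if "\<xi> \<in> \<Gamma>" for \<xi>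
      using image[OF that] S.outcome_\<N>_or_\<P> by metis
    fix \<xi> x p assume \<xi>: "\<xi> \<in> \<Gamma>" "misere_outcome \<xi> = \<N>" and x: "x |\<in>| options p \<xi>"
    have "x \<in> \<Gamma>" using closed_option[OF \<Gamma> \<xi>(1) x] .
    have "x + \<pi> |\<in>| options p (\<xi> + \<pi>)" using x by (simp add: options_plus_player)
    then have "misere_outcome (x + \<pi>) \<noteq> \<P>" using outcome_\<P>_option plus_\<pi>[OF \<xi>] by blast
    \<comment> \<open>If \<open>x\<close> were \<N>, then \<open>plus_\<pi>\<close> would make
      \<open>x + \<pi>\<close> a \<P>-position.\<close>
    then show "misere_outcome x = \<P>" using NP[OF \<open>x \<in> \<Gamma>\<close>] plus_\<pi>[OF \<open>x \<in> \<Gamma>\<close>] by auto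
  qed
qed

theorem theorem7p3p6:
  fixes \<Upsilon> :: "position set"
  shows "outcome_monoid_isomorphic (misere_monoid (cl \<Upsilon>)) (misere_monoid (cl {star})) \<longleftrightarrow>
    (\<exists>\<xi>\<in>\<Upsilon>. \<xi> \<noteq> 0) \<and>
    (\<forall>\<xi>\<in>cl \<Upsilon>. misere_outcome \<xi> \<in> {\<N>, \<P>}) \<and>
    (\<forall>\<xi>\<in>cl \<Upsilon>. misere_outcome \<xi> = \<N> \<longrightarrow>
       (\<forall>\<xi>L. \<xi>L |\<in>| left_opts \<xi> \<longrightarrow> misere_outcome \<xi>L = \<P>) \<and>
       (\<forall>\<xi>R. \<xi>R |\<in>| right_opts \<xi> \<longrightarrow> misere_outcome \<xi>R = \<P>))"
    (is "?iso \<longleftrightarrow> ?nontrivial \<and> ?NP \<and> ?opts")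
proof
  assume iso: ?iso
  interpret alternating "cl \<Upsilon>"
    by (rule isomorphic_imp_alternating[OF closed_positions_cl iso])
  obtain \<pi> where \<pi>: "\<pi> \<in> cl \<Upsilon>" "misere_outcome \<pi> = \<P>"
    using isomorphic_imp_alternating(2)[OF closed_positions_cl iso] by blast
  \<comment> \<open>\<open>0\<close> has outcome \<N>, so \<pi> is nonzero.\<close>
  then have "\<not> cl \<Upsilon> \<subseteq> {0}" using outcome_zero by auto
  then have ?nontrivial using cl_trivial by blast
  moreover have ?NP using outcome_\<N>_or_\<P> by blast
  moreover have ?opts
    using \<N>_option[where p = Left] \<N>_option[where p = Right] unfolding options.simps by blast
  ultimately show "?nontrivial \<and> ?NP \<and> ?opts" by blast
next
  assume conds: "?nontrivial \<and> ?NP \<and> ?opts"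
  have alt: "alternating (cl \<Upsilon>)"
  proof
    show "closed_positions (cl \<Upsilon>)" by (rule closed_positions_cl)
    show "misere_outcome \<xi> \<in> {\<N>, \<P>}" if "\<xi> \<in> cl \<Upsilon>" for \<xi>
      using conds that by blast
    show "misere_outcome x = \<P>"
      if "\<xi> \<in> cl \<Upsilon>" "misere_outcome \<xi> = \<N>" "x |\<in>| options p \<xi>" for \<xi> x p
    proof -
      have "x |\<in>| left_opts \<xi> \<or> x |\<in>| right_opts \<xi>"
        using that(3) by (cases p) simp_all
      then show ?thesis using conds that(1,2) by blast
    qed
  qed
  \<comment> \<open>Condition (1) enters here: a nonzero position supplies the \<P>-position without
    which the monoid would lack its second class.\<close>
  from conds obtain \<xi> where "\<xi> \<in> cl \<Upsilon>" "\<xi> \<noteq> 0" using subset_cl by blast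
  then obtain \<pi> where "\<pi> \<in> cl \<Upsilon>" "misere_outcome \<pi> = \<P>"
    using alternating.exists_\<P>[OF alt] by blast
  then show ?iso
    by (rule alternating_isomorphic[OF alt _ _ alternating_cl_star star_in_cl outcome_star])
qed

end
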